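(* Let $\alpha\in(0,1)$ and $\gamma\ge0$. Assume that the $p$-values $(p_i)_{i\in\mathbb{N}}$ are such that, for each $j\in\mathbb{N}$ and all $\boldsymbol\theta\in\boldsymbol\Theta$ with $\theta_j=0$ (i.e. such that the null hypothesis $H_j$ holds), $$\mathbb{P}_{\boldsymbol\theta}\big(p_j\le\alpha_j\,\big|\,\mathcal{F}_{j-1}\big)\le\alpha_j\qquad\text{almost surely.}$$ Then any generalized alpha investing rule (i.e. satisfying (G1) and (G2)) that in addition satisfies conditions (G3) and (G4) controls the false discovery exceedance: $$\mathrm{FDX}_\gamma\le\alpha .$$
   Context: Setting. $\mathbb{N}=\{1,2,\dots\}$. There is a sequence of null hypotheses $(H_i)_{i\in\mathbb{N}}$ with $H_i=\{\theta_i=0\}$, where $\theta_i$ belongs to a set $\Theta$ of possible parameter values and $\boldsymbol\theta=(\theta_i)_{i\in\mathbb{N}}\in\boldsymbol\Theta=\Theta^{\mathbb{N}}$. For each $\boldsymbol\theta$, $\mathbb{P}_{\boldsymbol\theta}$ is the joint law of the $[0,1]$-valued $p$-values $(p_i)_{i\in\mathbb{N}}$; if $\theta_i=0$ (true null) then $p_i$ is uniform on $[0,1]$ under $\mathbb{P}_{\boldsymbol\theta}$. Generalized alpha investing rule. A generalized alpha investing rule with parameters $w_0\ge0$, $b_0>0$ is given by functions $\alpha_j,\varphi_j,\psi_j:\{0,1\}^{j-1}\to[0,\infty)$, $j\in\mathbb{N}$. Decisions are $R_j=1$ (reject $H_j$) if $p_j\le\alpha_j(R_1,\dots,R_{j-1})$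 and $R_j=0$ otherwise. The potential is $W(0)=w_0$, $W(j)=W(j-1)-\varphi_j(R_1,\dots,R_{j-1})+R_j\,\psi_j(R_1,\dots,R_{j-1})$, viewed as a function of $(R_1,\dots,R_j)\in\{0,1\}^j$. Write $\alpha_j,\varphi_j,\psi_j$ also for the values at $(R_1,\dots,R_{j-1})$. It is required that, for all $j\in\mathbb{N}$ and all $(R_1,\dots,R_{j-1})\in\{0,1\}^{j-1}$: (G1) $\psi_j\le\varphi_j+b_0$; $\ \psi_j\le \varphi_j/\alpha_j+b_0-1$ (with $\varphi_j/\alpha_j:=+\infty$ when $\alpha_j=0$); and $\varphi_j\le W(j-1)$. (G2) if $W(j-1)=0$ then $\alpha_j=0$. $\mathcal{F}_j$ is the $\sigma$-algebra generated by $R_1,\dots,R_j$ ($\mathcal{F}_0$ trivial). Additional conditions. Let $M(0)=\gamma-b_0-w_0$ and, for $n\in\mathbb{N}$, $M(n)=M(0)+\sum_{j=1}^nM_j$, where $$M_j=\max\{(1+\psi_j-b_0)(\alpha_j-R_j),\ (b_0-\psi_j)R_j,\ \psi_j-b_0\},$$ and let $\xi_j=\max\{(1+\psi_j-b_0)\alpha_j,\ |b_0-\psi_j|\}$. (G3) $w_0<\gamma-b_0$. (G4) For all $j\in\mathbb{N}$ and all $(R_1,\dots,R_j)\in\{0,1\}^j$: if $M(j)+\xi_{j+1}>\dfrac{\gamma-b_0-w_0}{1-\alpha}$, then $\alpha_i=0$ for all $i>j$. FDX. $R(n)=\sum_{i=1}^nR_i$, $V^{\boldsymbol\theta}(n)=\#\{i\le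 n:R_i=1,\theta_i=0\}$, $\mathrm{FDP}^{\boldsymbol\theta}(n)=V^{\boldsymbol\theta}(n)/\max(R(n),1)$, and $$\mathrm{FDX}_\gamma=\sup_{\boldsymbol\theta\in\boldsymbol\Theta}\mathbb{P}_{\boldsymbol\theta}\Big(\sup_{n\ge1}\mathrm{FDP}^{\boldsymbol\theta}(n)\ge\gamma\Big).$$
   Formalization: Condition (G4) is required also for j=0 (the empty history, with M(0)+ξ_1), since with only j≥1 the first level α_1 is not constrained by α and the claim fails (e.g. γ=1, b_0=0.1, w_0=φ_1=0.81, α_1=0.9, ψ_1=0, all later functions zero). *)

theory Defs
  imports "HOL-Probability.Probability"
begin

text \<open>
  Hypotheses, p-values and decisions are indexed by the positive integers; index 0 is never used.
  A decision history \<open>(R\<^sub>1,\<dots>,R\<^sub>j)\<close> in \<open>{0,1}\<^sup>j\<close> is a Boolean list of length \<open>j\<close>, with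
  \<open>R\<^sub>i\<close> at list position \<open>i - 1\<close>. A function with domain \<open>{0,1}\<^sup>j\<^sup>-\<^sup>1\<close>, indexed by \<open>j\<close>,
  is given by its values \<open>f j s\<close> with \<open>j \<ge> 1\<close> and \<open>length s = j - 1\<close>.
\<close>

type_synonym rule_fun = "nat \<Rightarrow> bool list \<Rightarrow> real"


subsection \<open>Generalized alpha investing rules\<close>

text \<open>\<open>W(j)\<close> depends only on the first \<open>j\<close> entries of \<open>r\<close>.\<close>

fun potential :: "real \<Rightarrow> rule_fun \<Rightarrow> rule_fun \<Rightarrow> nat \<Rightarrow> bool list \<Rightarrow> real" where
  "potential w0 \<phi> \<psi> 0 r = w0"
| "potential w0 \<phi> \<psi> (Suc j) r =
     potential w0 \<phi> \<psi> j r - \<phi> (Suc j) (take j r) + of_bool (r ! j) * \<psi> (Suc j) (take j r)"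

text \<open>The premise \<open>0 < a j s\<close> encodes the convention \<open>\<phi>\<^sub>j/\<alpha>\<^sub>j = +\<infinity>\<close> for \<open>\<alpha>\<^sub>j = 0\<close>.\<close>

definition G1 :: "real \<Rightarrow> real \<Rightarrow> rule_fun \<Rightarrow> rule_fun \<Rightarrow> rule_fun \<Rightarrow> bool" where
  "G1 w0 b0 a \<phi> \<psi> \<longleftrightarrow> (\<forall>j\<ge>1. \<forall>s. length s = j - 1 \<longrightarrow>
     \<psi> j s \<le> \<phi> j s + b0 \<and>
     (0 < a j s \<longrightarrow> \<psi> j s \<le> \<phi> j s / a j s + b0 - 1) \<and>
     \<phi> j s \<le> potential w0 \<phi> \<psi> (j - 1) s)"

definition G2 :: "real \<Rightarrow> rule_fun \<Rightarrow> rule_fun \<Rightarrow> rule_fun \<Rightarrow> bool" where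
  "G2 w0 a \<phi> \<psi> \<longleftrightarrow> (\<forall>j\<ge>1. \<forall>s. length s = j - 1 \<longrightarrow>
     potential w0 \<phi> \<psi> (j - 1) s = 0 \<longrightarrow> a j s = 0)"

definition gai_rule :: "real \<Rightarrow> real \<Rightarrow> rule_fun \<Rightarrow> rule_fun \<Rightarrow> rule_fun \<Rightarrow> bool" where
  "gai_rule w0 b0 a \<phi> \<psi> \<longleftrightarrow>
     0 \<le> w0 \<and> 0 < b0 \<and>
     (\<forall>j\<ge>1. \<forall>s. length s = j - 1 \<longrightarrow> 0 \<le> a j s \<and> 0 \<le> \<phi> j s \<and> 0 \<le> \<psi> j s) \<and>
     G1 w0 b0 a \<phi> \<psi> \<and> G2 w0 a \<phi> \<psi>"


subsection \<open>The additional conditions\<close>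

text \<open>\<open>M\<^sub>j\<close>, with \<open>s = (R\<^sub>1,\<dots>,R\<^sub>j\<^sub>-\<^sub>1)\<close> and \<open>\<rho> = R\<^sub>j\<close>.\<close>

definition M_incr :: "real \<Rightarrow> rule_fun \<Rightarrow> rule_fun \<Rightarrow> nat \<Rightarrow> bool list \<Rightarrow> bool \<Rightarrow> real" where
  "M_incr b0 a \<psi> j s \<rho> =
     Max {(1 + \<psi> j s - b0) * (a j s - of_bool \<rho>), (b0 - \<psi> j s) * of_bool \<rho>, \<psi> j s - b0}"

definition M_total ::
  "real \<Rightarrow> real \<Rightarrow> real \<Rightarrow> rule_fun \<Rightarrow> rule_fun \<Rightarrow> nat \<Rightarrow> bool list \<Rightarrow> real" where
  "M_total \<gamma> w0 b0 a \<psi> n r =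
     (\<gamma> - b0 - w0) + (\<Sum>j=1..n. M_incr b0 a \<psi> j (take (j - 1) r) (r ! (j - 1)))"

definition xi :: "real \<Rightarrow> rule_fun \<Rightarrow> rule_fun \<Rightarrow> nat \<Rightarrow> bool list \<Rightarrow> real" where
  "xi b0 a \<psi> j s = max ((1 + \<psi> j s - b0) * a j s) \<bar>b0 - \<psi> j s\<bar>"

definition G3 :: "real \<Rightarrow> real \<Rightarrow> real \<Rightarrow> bool" where
  "G3 \<gamma> w0 b0 \<longleftrightarrow> w0 < \<gamma> - b0"

text \<open>
  Since \<open>\<alpha>\<^sub>i\<close> is a function of \<open>(R\<^sub>1,\<dots>,R\<^sub>i\<^sub>-\<^sub>1)\<close>, its vanishing for \<open>i > j\<close> means vanishing on
  every continuation of \<open>(R\<^sub>1,\<dots>,R\<^sub>j)\<close>.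

  The case \<open>j = 0\<close> is included: otherwise the first test level would not be constrained by
  \<open>\<alpha>\<close> at all. For instance \<open>\<gamma> = 1\<close>, \<open>b\<^sub>0 = 0.1\<close>, \<open>w\<^sub>0 = \<phi>\<^sub>1 = 0.81\<close>, \<open>\<alpha>\<^sub>1 = 0.9\<close>, \<open>\<psi>\<^sub>1 = 0\<close>
  and \<open>\<alpha>\<^sub>j = \<phi>\<^sub>j = \<psi>\<^sub>j = 0\<close> for \<open>j \<ge> 2\<close> would be admissible for every \<open>\<alpha>\<close>, while its exceedance
  probability under independent uniform p-values is 0.9.
\<close>

definition G4 ::
  "real \<Rightarrow> real \<Rightarrow> real \<Rightarrow> real \<Rightarrow> rule_fun \<Rightarrow> rule_fun \<Rightarrow> bool" where
  "G4 \<alpha> \<gamma> w0 b0 a \<psi> \<longleftrightarrow> (\<forall>j. \<forall>r. length r = j \<longrightarrow>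
     M_total \<gamma> w0 b0 a \<psi> j r + xi b0 a \<psi> (j + 1) r > (\<gamma> - b0 - w0) / (1 - \<alpha>) \<longrightarrow>
     (\<forall>i>j. \<forall>s. length s = i - 1 \<and> take j s = r \<longrightarrow> a i s = 0))"


subsection \<open>Decisions and the false discovery proportion\<close>

text \<open>\<open>decisions a x j\<close> is \<open>(R\<^sub>1,\<dots>,R\<^sub>j)\<close> for the realized p-value sequence \<open>x\<close>.\<close>

fun decisions :: "rule_fun \<Rightarrow> (nat \<Rightarrow> real) \<Rightarrow> nat \<Rightarrow> bool list" where
  "decisions a x 0 = []"
| "decisions a x (Suc j) =
     decisions a x j @ [x (Suc j) \<le> a (Suc j) (decisions a x j)]"

definition rejected :: "rule_fun \<Rightarrow> (nat \<Rightarrow> real) \<Rightarrow> nat \<Rightarrow> bool" where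
  "rejected a x j \<longleftrightarrow> x j \<le> a j (decisions a x (j - 1))"

definition num_rejections :: "rule_fun \<Rightarrow> (nat \<Rightarrow> real) \<Rightarrow> nat \<Rightarrow> nat" where
  "num_rejections a x n = (\<Sum>i=1..n. of_bool (rejected a x i))"

definition num_false_rejections ::
  "rule_fun \<Rightarrow> (nat \<Rightarrow> 't::zero) \<Rightarrow> (nat \<Rightarrow> real) \<Rightarrow> nat \<Rightarrow> nat" where
  "num_false_rejections a \<theta> x n = card {i \<in> {1..n}. rejected a x i \<and> \<theta> i = 0}"

definition FDP :: "rule_fun \<Rightarrow> (nat \<Rightarrow> 't::zero) \<Rightarrow> (nat \<Rightarrow> real) \<Rightarrow> nat \<Rightarrow> real" where
  "FDP a \<theta> x n = real (num_false_rejections a \<theta> x n) / real (max (num_rejections a x n) 1)"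


subsection \<open>The statistical model and the false discovery exceedance\<close>

abbreviation parameters :: "'t set \<Rightarrow> (nat \<Rightarrow> 't) set" where
  "parameters \<Theta> \<equiv> {1..} \<rightarrow>\<^sub>E \<Theta>"

text \<open>
  The p-values are random variables on a measurable space \<open>\<Omega>\<close> carrying one probability measure
  per parameter sequence; taking \<open>\<Omega>\<close> to be the sequence space and \<open>p\<close> the coordinates
  gives the joint laws themselves.
\<close>

definition p_value_model ::
  "'t::zero set \<Rightarrow> 'w measure \<Rightarrow> ((nat \<Rightarrow> 't) \<Rightarrow> 'w measure) \<Rightarrow> (nat \<Rightarrow> 'w \<Rightarrow> real) \<Rightarrow> bool" where
  "p_value_model \<Theta> \<Omega> P p \<longleftrightarrow>
     (\<forall>i\<ge>1. p i \<in> borel_measurable \<Omega> \<and> (\<forall>\<omega>\<in>space \<Omega>. p i \<omega> \<in> {0..1})) \<and>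
     (\<forall>\<theta>\<in>parameters \<Theta>. prob_space (P \<theta>) \<and> sets (P \<theta>) = sets \<Omega> \<and>
        (\<forall>i\<ge>1. \<theta> i = 0 \<longrightarrow> distr (P \<theta>) borel (p i) = uniform_measure lborel {0..1}))"

definition decision_algebra ::
  "'w measure \<Rightarrow> (nat \<Rightarrow> 'w \<Rightarrow> real) \<Rightarrow> rule_fun \<Rightarrow> nat \<Rightarrow> 'w measure" where
  "decision_algebra \<Omega> p a j =
     sigma (space \<Omega>) {{\<omega> \<in> space \<Omega>. rejected a (\<lambda>k. p k \<omega>) i} | i. i \<in> {1..j}}"

definition cond_superuniform ::
  "'t::zero set \<Rightarrow> 'w measure \<Rightarrow> ((nat \<Rightarrow> 't) \<Rightarrow> 'w measure) \<Rightarrow> (nat \<Rightarrow> 'w \<Rightarrow> real) \<Rightarrow> rule_fun \<Rightarrow> bool" where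
  "cond_superuniform \<Theta> \<Omega> P p a \<longleftrightarrow>
     (\<forall>j\<ge>1. \<forall>\<theta>\<in>parameters \<Theta>. \<theta> j = 0 \<longrightarrow>
        (AE \<omega> in P \<theta>.
           real_cond_exp (P \<theta>) (decision_algebra \<Omega> p a (j - 1))
             (indicator {\<omega> \<in> space \<Omega>. p j \<omega> \<le> a j (decisions a (\<lambda>k. p k \<omega>) (j - 1))}) \<omega>
           \<le> a j (decisions a (\<lambda>k. p k \<omega>) (j - 1))))"

definition FDX ::
  "real \<Rightarrow> 't::zero set \<Rightarrow> 'w measure \<Rightarrow> ((nat \<Rightarrow> 't) \<Rightarrow> 'w measure) \<Rightarrow> (nat \<Rightarrow> 'w \<Rightarrow> real) \<Rightarrow> rule_fun \<Rightarrow> ennreal" where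
  "FDX \<gamma> \<Theta> \<Omega> P p a =
     (SUP \<theta>\<in>parameters \<Theta>.
        emeasure (P \<theta>) {\<omega> \<in> space \<Omega>. (SUP n\<in>{1..}. FDP a \<theta> (\<lambda>k. p k \<omega>) n) \<ge> \<gamma>})"

end

theory Submission
  imports Defs
begin

text \<open>
  Fix \<open>\<theta>\<close> and start from the process
  \<open>\<gamma> - b0 + b0 R(n) - V(n) - W(n)\<close>, whose value at \<open>n = 0\<close> is \<open>\<gamma> - b0 - w0 > 0\<close>.
  Since \<open>W \<ge> 0\<close> and \<open>b0 < \<gamma>\<close>, a false discovery proportion of at least \<open>\<gamma>\<close> forces this
  process to be at most \<open>0\<close>, so it suffices that it stays positive with probability at least
  \<open>1 - \<alpha>\<close>. It is a submartingale, but its payments \<open>\<phi>\<^sub>j\<close> admit no useful upper bound, so it is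
  replaced by a smaller process, the budget \<open>X\<close>, with the same starting value and increments
  \<open>max 0 (1 + \<psi>\<^sub>j - b0) * (\<alpha>\<^sub>j - R\<^sub>j)\<close> at true nulls and \<open>0\<close> elsewhere. The condition (G1) is
  what makes these increments smaller (\<open>budget_incr_le\<close>, \<open>budget_le\<close>).

  The budget is still a submartingale, because the weight \<open>max 0 (1 + \<psi>\<^sub>j - b0)\<close> is nonnegative
  and determined by the past, and \<open>\<alpha>\<^sub>j\<close> bounds the conditional rejection probability
  (\<open>budget_step_nonneg\<close>). On the other hand its increments are bounded by \<open>M\<^sub>j\<close>, hence \<open>X \<le> M\<close>,
  and a single increment is at most \<open>\<xi>\<^sub>j\<close>; so (G4) switches testing off before the budget can exceed
  \<open>K = (\<gamma> - b0 - w0) / (1 - \<alpha>)\<close> (\<open>budget_le_cap\<close>).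

  A submartingale that starts at \<open>x0\<close> and never exceeds \<open>K\<close> stays positive forever with
  probability at least \<open>x0 / K\<close> (\<open>positivity_probability\<close>), which here is \<open>1 - \<alpha>\<close>. On
  that event the supremum of the false discovery proportions is strictly below \<open>\<gamma>\<close>, not merely
  each proportion (\<open>SUP_FDP_less\<close>).
\<close>

section \<open>A maximal inequality\<close>

text \<open>
  This is Ville's inequality for the nonnegative supermartingale \<open>K - X\<close>. The truncated
  expectation \<open>E[X\<^sub>n; A\<^sub>n]\<close>, where \<open>A\<^sub>n\<close> says that \<open>X\<close> is positive up to time \<open>n\<close>, never
  decreases: a step inside \<open>A\<^sub>n\<close> has nonnegative mean, and passing from \<open>A\<^sub>n\<close> to
  \<open>A\<^sub>n\<^sub>+\<^sub>1\<close> discards only nonpositive values. Hence \<open>x0 \<le> E[X\<^sub>n; A\<^sub>n] \<le> K P(A\<^sub>n)\<close>.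
\<close>
lemma (in prob_space) positivity_probability:
  fixes X :: "nat \<Rightarrow> 'a \<Rightarrow> real"
  assumes int: "\<And>n. integrable M (X n)"
    and start: "\<And>\<omega>. \<omega> \<in> space M \<Longrightarrow> X 0 \<omega> = x0" and "0 < x0"
    and cap: "\<And>n \<omega>. \<omega> \<in> space M \<Longrightarrow> X n \<omega> \<le> K"
    and step: "\<And>n. (\<integral>\<omega>. indicator {\<omega> \<in> space M. \<forall>k\<le>n. 0 < X k \<omega>} \<omega> * (X (Suc n) \<omega> - X n \<omega>) \<partial>M) \<ge> 0"
  shows "x0 / K \<le> prob {\<omega> \<in> space M. \<forall>n. 0 < X n \<omega>}"
proof -
  have [measurable]: "\<And>n. X n \<in> borel_measurable M"
    using int by auto
  define A where "A n = {\<omega> \<in> space M. \<forall>k\<le>n. 0 < X k \<omega>}" for n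
  have A_sets [measurable]: "A n \<in> sets M" for n
    unfolding A_def by measurable
  have intA: "integrable M (\<lambda>\<omega>. indicator (A m) \<omega> * X n \<omega>)" for m n
    using integrable_mult_indicator[OF A_sets int, of m n] by simp
  have lower: "x0 \<le> (\<integral>\<omega>. indicator (A n) \<omega> * X n \<omega> \<partial>M)" for n
  proof (induction n)
    case 0
    have "(\<integral>\<omega>. indicator (A 0) \<omega> * X 0 \<omega> \<partial>M) = (\<integral>\<omega>. x0 \<partial>M)"
      using start \<open>0 < x0\<close> by (intro Bochner_Integration.integral_cong) (auto simp: A_def)
    then show ?case
      by (simp add: prob_space)
  next
    case (Suc n)
    have "(\<integral>\<omega>. indicator (A n) \<omega> * (X (Suc n) \<omega> - X n \<omega>) \<partial>M)
        = (\<integral>\<omega>. indicator (A n) \<omega> * X (Suc n) \<omega> \<partial>M) - (\<integral>\<omega>. indicator (A n) \<omega> * X n \<omega> \<partial>M)"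
      by (simp add: right_diff_distrib intA)
    with step[of n] have "(\<integral>\<omega>. indicator (A n) \<omega> * X n \<omega> \<partial>M) \<le> (\<integral>\<omega>. indicator (A n) \<omega> * X (Suc n) \<omega> \<partial>M)"
      unfolding A_def by linarith
    also have "\<dots> \<le> (\<integral>\<omega>. indicator (A (Suc n)) \<omega> * X (Suc n) \<omega> \<partial>M)"
    proof (rule integral_mono[OF intA intA])
      fix \<omega> assume "\<omega> \<in> space M"
      \<comment> \<open>A path that leaves \<open>A\<close> at time \<open>n + 1\<close> does so at a nonpositive value.\<close>
      then show "indicator (A n) \<omega> * X (Suc n) \<omega> \<le> indicator (A (Suc n)) \<omega> * X (Suc n) \<omega>"
        by (auto simp: A_def indicator_def not_less le_Suc_eq)
    qed
    finally show ?case
      using Suc by linarith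
  qed
  obtain \<omega> where "\<omega> \<in> space M"
    using not_empty by blast
  then have "0 < K"
    using start cap[of \<omega> 0] \<open>0 < x0\<close> by simp
  have "x0 / K \<le> prob (A n)" for n
  proof -
    have "x0 \<le> (\<integral>\<omega>. indicator (A n) \<omega> * X n \<omega> \<partial>M)"
      by (rule lower)
    also have "\<dots> \<le> (\<integral>\<omega>. indicator (A n) \<omega> * K \<partial>M)"
    proof (rule integral_mono[OF intA])
      show "integrable M (\<lambda>\<omega>. indicator (A n) \<omega> * K)"
        by (intro integrable_mult_left) (simp add: emeasure_eq_measure)
    qed (simp add: cap mult_left_mono)
    also have "\<dots> = prob (A n) * K"
      by simp
    finally show ?thesis
      using \<open>0 < K\<close> by (simp add: divide_le_eq)
  qed
  moreover have "(\<lambda>n. prob (A n)) \<longlonglongrightarrow> prob (\<Inter>n. A n)"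
    by (rule finite_Lim_measure_decseq) (use A_sets in \<open>auto simp: decseq_def A_def\<close>)
  ultimately have "x0 / K \<le> prob (\<Inter>n. A n)"
    by (intro LIMSEQ_le_const) auto
  moreover have "(\<Inter>n. A n) = {\<omega> \<in> space M. \<forall>n. 0 < X n \<omega>}"
    by (auto simp: A_def)
  ultimately show ?thesis
    by simp
qed


section \<open>Decision histories\<close>

lemma length_decisions [simp]: "length (decisions a x n) = n"
  by (induction n) auto

lemma take_decisions: "m \<le> n \<Longrightarrow> take m (decisions a x n) = decisions a x m"
  by (induction n) (auto simp: le_Suc_eq)

lemma decisions_Suc: "decisions a x (Suc n) = decisions a x n @ [rejected a x (Suc n)]"
  by (simp add: rejected_def)

declare decisions.simps(2) [simp del]

lemma nth_decisions: "i < n \<Longrightarrow> decisions a x n ! i = rejected a x (Suc i)"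
  by (induction n) (auto simp: decisions_Suc nth_append less_Suc_eq)

text \<open>
  The measurable space is arbitrary so that the lemma covers both the sample space, where it yields
  integrability, and the algebra generated by the decisions, on which one conditions.
\<close>
lemma measurable_decisions:
  assumes "\<And>i. i \<in> {1..n} \<Longrightarrow> {\<omega> \<in> space N. rejected a (\<lambda>k. p k \<omega>) i} \<in> sets N"
  shows "(\<lambda>\<omega>. decisions a (\<lambda>k. p k \<omega>) n) \<in> N \<rightarrow>\<^sub>M count_space UNIV"
  using assms
proof (induction n)
  case 0
  then show ?case by simp
next
  case (Suc n)
  then have [measurable]: "(\<lambda>\<omega>. decisions a (\<lambda>k. p k \<omega>) n) \<in> N \<rightarrow>\<^sub>M count_space UNIV"
    and [measurable]: "{\<omega> \<in> space N. rejected a (\<lambda>k. p k \<omega>) (Suc n)} \<in> sets N"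
    by auto
  have [measurable]: "Measurable.pred N (\<lambda>\<omega>. rejected a (\<lambda>k. p k \<omega>) (Suc n))"
    by (simp add: pred_def)
  show ?case
    unfolding decisions_Suc by measurable
qed

lemma rejected_sets:
  fixes p :: "nat \<Rightarrow> 'w \<Rightarrow> real"
  assumes meas: "\<And>i. 1 \<le> i \<Longrightarrow> p i \<in> borel_measurable N" and "1 \<le> i"
  shows "{\<omega> \<in> space N. rejected a (\<lambda>k. p k \<omega>) i} \<in> sets N"
  using \<open>1 \<le> i\<close>
proof (induction i rule: less_induct)
  case (less i)
  have [measurable]: "(\<lambda>\<omega>. decisions a (\<lambda>k. p k \<omega>) (i - 1)) \<in> N \<rightarrow>\<^sub>M count_space UNIV"
    by (rule measurable_decisions, rule less.IH) (use less.prems in auto)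
  have [measurable]: "p i \<in> borel_measurable N"
    using meas less.prems by simp
  show ?case
    unfolding rejected_def by measurable
qed

text \<open>There are only finitely many histories of a given length, so every function of one is bounded.\<close>
lemma integrable_finite_history:
  fixes g :: "bool list \<Rightarrow> real"
  assumes "finite_measure N" and "(\<lambda>\<omega>. decisions a (\<lambda>k. p k \<omega>) n) \<in> N \<rightarrow>\<^sub>M count_space UNIV"
  shows "integrable N (\<lambda>\<omega>. g (decisions a (\<lambda>k. p k \<omega>) n))"
proof -
  interpret finite_measure N by fact
  note [measurable] = assms(2)
  have "finite {s :: bool list. length s = n}"
    using finite_lists_length_eq[of "UNIV :: bool set" n] by simp
  then have "\<bar>g (decisions a (\<lambda>k. p k \<omega>) n)\<bar> \<le> (\<Sum>s | length s = n. \<bar>g s\<bar>)" for \<omega>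
    by (intro member_le_sum) auto
  then show ?thesis
    by (intro integrable_const_bound[where B = "\<Sum>s | length s = n. \<bar>g s\<bar>"]) auto
qed

lemma subalgebra_decision_algebra:
  fixes p :: "nat \<Rightarrow> 'w \<Rightarrow> real"
  assumes "sets N = sets \<Omega>" and "\<And>i. 1 \<le> i \<Longrightarrow> p i \<in> borel_measurable \<Omega>"
  shows "subalgebra N (decision_algebra \<Omega> p a n)"
proof -
  have "{{\<omega> \<in> space \<Omega>. rejected a (\<lambda>k. p k \<omega>) i} | i. i \<in> {1..n}} \<subseteq> sets \<Omega>"
    using rejected_sets[of p \<Omega> _ a] assms(2) by auto
  then have "sets (decision_algebra \<Omega> p a n) \<subseteq> sets \<Omega>"
    unfolding decision_algebra_def by (subst sets_measure_of) (auto dest: sets.sigma_sets_subset)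
  then show ?thesis
    using sets_eq_imp_space_eq[OF assms(1)] assms(1)
    by (simp add: subalgebra_def decision_algebra_def space_measure_of_conv)
qed

lemma measurable_decisions_decision_algebra:
  fixes p :: "nat \<Rightarrow> 'w \<Rightarrow> real"
  assumes "m \<le> n"
  shows "(\<lambda>\<omega>. decisions a (\<lambda>k. p k \<omega>) m) \<in> decision_algebra \<Omega> p a n \<rightarrow>\<^sub>M count_space UNIV"
proof (rule measurable_decisions)
  fix i assume "i \<in> {1..m}"
  then have "{\<omega> \<in> space \<Omega>. rejected a (\<lambda>k. p k \<omega>) i}
      \<in> {{\<omega> \<in> space \<Omega>. rejected a (\<lambda>k. p k \<omega>) i} | i. i \<in> {1..n}}"
    using assms by auto
  then show "{\<omega> \<in> space (decision_algebra \<Omega> p a n). rejected a (\<lambda>k. p k \<omega>) i}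
      \<in> sets (decision_algebra \<Omega> p a n)"
    unfolding decision_algebra_def
    by (subst sets_measure_of, blast) (auto simp: space_measure_of_conv)
qed


section \<open>The budget process\<close>

text \<open>
  The weight is truncated at zero because \<open>1 + \<psi>\<^sub>j - b0\<close> may be negative when \<open>b0 > 1\<close>; the
  untruncated increment would then have nonpositive conditional mean.
\<close>
definition budget_incr ::
  "real \<Rightarrow> rule_fun \<Rightarrow> rule_fun \<Rightarrow> (nat \<Rightarrow> 't::zero) \<Rightarrow> nat \<Rightarrow> bool list \<Rightarrow> bool \<Rightarrow> real" where
  "budget_incr b0 a \<psi> \<theta> j s \<rho> =
     (if \<theta> j = 0 then max 0 (1 + \<psi> j s - b0) * (a j s - of_bool \<rho>) else 0)"

text \<open>
  As with \<open>M_total\<close>, the process is a function of the history, so that events about its past are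
  events about the decisions and hence measurable with respect to the decision algebra.
\<close>
definition budget ::
  "real \<Rightarrow> real \<Rightarrow> real \<Rightarrow> rule_fun \<Rightarrow> rule_fun \<Rightarrow> (nat \<Rightarrow> 't::zero) \<Rightarrow> nat \<Rightarrow> bool list \<Rightarrow> real" where
  "budget \<gamma> w0 b0 a \<psi> \<theta> n r =
     (\<gamma> - b0 - w0) + (\<Sum>j=1..n. budget_incr b0 a \<psi> \<theta> j (take (j - 1) r) (r ! (j - 1)))"

lemma budget_0 [simp]: "budget \<gamma> w0 b0 a \<psi> \<theta> 0 r = \<gamma> - b0 - w0"
  by (simp add: budget_def)

lemma budget_decisions:
  "budget \<gamma> w0 b0 a \<psi> \<theta> n (decisions a x n) = (\<gamma> - b0 - w0) +
    (\<Sum>j=1..n. budget_incr b0 a \<psi> \<theta> j (decisions a x (j - 1)) (rejected a x j))"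
  unfolding budget_def by (auto intro!: sum.cong simp: take_decisions nth_decisions)

lemma budget_Suc:
  "budget \<gamma> w0 b0 a \<psi> \<theta> (Suc n) (decisions a x (Suc n)) =
     budget \<gamma> w0 b0 a \<psi> \<theta> n (decisions a x n) +
     budget_incr b0 a \<psi> \<theta> (Suc n) (decisions a x n) (rejected a x (Suc n))"
  by (simp add: budget_decisions)

lemma M_total_decisions:
  "M_total \<gamma> w0 b0 a \<psi> n (decisions a x n) = (\<gamma> - b0 - w0) +
    (\<Sum>j=1..n. M_incr b0 a \<psi> j (decisions a x (j - 1)) (rejected a x j))"
  unfolding M_total_def by (auto intro!: sum.cong simp: take_decisions nth_decisions)

text \<open>
  The increment is either the first entry of the maximum or zero, and the last two entries make
  the maximum nonnegative when \<open>\<rho> = 1\<close>; when \<open>\<rho> = 0\<close> the second entry is zero.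
\<close>
lemma budget_incr_le_M_incr:
  assumes "0 \<le> a j s" and "0 \<le> \<psi> j s"
  shows "budget_incr b0 a \<psi> \<theta> j s \<rho> \<le> M_incr b0 a \<psi> j s \<rho>"
proof -
  have "(1 + \<psi> j s - b0) * (a j s - of_bool \<rho>) \<le> M_incr b0 a \<psi> j s \<rho>"
    unfolding M_incr_def by (rule Max_ge) auto
  moreover have "(b0 - \<psi> j s) * of_bool \<rho> \<le> M_incr b0 a \<psi> j s \<rho>"
    unfolding M_incr_def by (rule Max_ge) auto
  moreover have "\<psi> j s - b0 \<le> M_incr b0 a \<psi> j s \<rho>"
    unfolding M_incr_def by (rule Max_ge) auto
  ultimately show ?thesis
    by (cases \<rho>) (auto simp: budget_incr_def max_def)
qed

lemma budget_le_M_total: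
  assumes "gai_rule w0 b0 a \<phi> \<psi>"
  shows "budget \<gamma> w0 b0 a \<psi> \<theta> n (decisions a x n) \<le> M_total \<gamma> w0 b0 a \<psi> n (decisions a x n)"
  using assms unfolding M_total_decisions budget_decisions
  by (auto intro!: sum_mono budget_incr_le_M_incr simp: gai_rule_def)

text \<open>
  Only a true null with \<open>\<alpha>\<^sub>n\<^sub>+\<^sub>1 > 0\<close> can increase the budget, and then (G4) guarantees
  \<open>M(n) + \<xi>\<^sub>n\<^sub>+\<^sub>1 \<le> K\<close>, which dominates the budget after the step.
\<close>
lemma budget_le_cap:
  assumes gai: "gai_rule w0 b0 a \<phi> \<psi>" and G3: "G3 \<gamma> w0 b0" and G4: "G4 \<alpha> \<gamma> w0 b0 a \<psi>"
    and \<alpha>: "0 < \<alpha>" "\<alpha> < 1"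
  shows "budget \<gamma> w0 b0 a \<psi> \<theta> n (decisions a x n) \<le> (\<gamma> - b0 - w0) / (1 - \<alpha>)"
proof (induction n)
  case 0
  show ?case
    using G3 \<alpha> by (simp add: G3_def pos_le_divide_eq mult_le_cancel_left1)
next
  case (Suc n)
  define s where "s = decisions a x n"
  let ?D = "budget_incr b0 a \<psi> \<theta> (Suc n) s (rejected a x (Suc n))"
  have nonneg: "0 \<le> a (Suc n) s"
    using gai by (simp add: gai_rule_def s_def)
  show ?case
  proof (cases "M_total \<gamma> w0 b0 a \<psi> n s + xi b0 a \<psi> (n + 1) s > (\<gamma> - b0 - w0) / (1 - \<alpha>)")
    case True
    have "length s = n"
      by (simp add: s_def)
    with True have "a (Suc n) s = 0"
      using G4[unfolded G4_def, rule_format, of s n "Suc n" s] by simp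
    then have "?D \<le> 0"
      by (simp add: budget_incr_def mult_nonneg_nonpos)
    with Suc show ?thesis
      by (simp add: budget_Suc s_def)
  next
    case False
    have "?D \<le> max 0 (1 + \<psi> (Suc n) s - b0) * a (Suc n) s"
      using nonneg by (auto simp: budget_incr_def intro!: mult_left_mono)
    also have "\<dots> \<le> xi b0 a \<psi> (Suc n) s"
      using nonneg by (auto simp: xi_def max_def)
    finally show ?thesis
      using False budget_le_M_total[OF gai, of \<gamma> \<theta> n x] by (simp add: budget_Suc s_def)
  qed
qed


section \<open>The budget bounds the false discovery proportion\<close>

lemma potential_take: "n \<le> k \<Longrightarrow> potential w0 \<phi> \<psi> n (take k r) = potential w0 \<phi> \<psi> n r"
  by (induction n) (auto simp: min_def)

lemma potential_Suc:
  "potential w0 \<phi> \<psi> (Suc n) (decisions a x (Suc n)) =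
     potential w0 \<phi> \<psi> n (decisions a x n) - \<phi> (Suc n) (decisions a x n)
     + of_bool (rejected a x (Suc n)) * \<psi> (Suc n) (decisions a x n)"
  using potential_take[of n n w0 \<phi> \<psi> "decisions a x (Suc n)"]
  by (simp add: take_decisions nth_decisions)

lemma potential_nonneg:
  assumes "gai_rule w0 b0 a \<phi> \<psi>"
  shows "0 \<le> potential w0 \<phi> \<psi> n (decisions a x n)"
proof (induction n)
  case 0
  then show ?case
    using assms by (simp add: gai_rule_def)
next
  case (Suc n)
  have "\<phi> (Suc n) (decisions a x n) \<le> potential w0 \<phi> \<psi> n (decisions a x n)"
    and "0 \<le> \<psi> (Suc n) (decisions a x n)"
    using assms[unfolded gai_rule_def G1_def] by (metis diff_Suc_1 length_decisions le_add1 plus_1_eq_Suc)+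
  then show ?case
    unfolding potential_Suc by simp
qed

lemma num_rejections_Suc:
  "num_rejections a x (Suc n) = num_rejections a x n + of_bool (rejected a x (Suc n))"
  by (simp add: num_rejections_def)

lemma num_false_rejections_Suc:
  "num_false_rejections a \<theta> x (Suc n) =
     num_false_rejections a \<theta> x n + of_bool (rejected a x (Suc n) \<and> \<theta> (Suc n) = 0)"
proof -
  have "{i \<in> {1..Suc n}. rejected a x i \<and> \<theta> i = 0} =
      (if rejected a x (Suc n) \<and> \<theta> (Suc n) = 0
       then insert (Suc n) {i \<in> {1..n}. rejected a x i \<and> \<theta> i = 0}
       else {i \<in> {1..n}. rejected a x i \<and> \<theta> i = 0})"
    by (auto simp: le_Suc_eq)
  then show ?thesis
    unfolding num_false_rejections_def by simp
qed

lemma num_false_rejections_le: "num_false_rejections a \<theta> x n \<le> num_rejections a x n"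
proof (induction n)
  case 0
  then show ?case
    by (simp add: num_false_rejections_def)
next
  case (Suc n)
  then show ?case
    by (simp add: num_rejections_Suc num_false_rejections_Suc)
qed

text \<open>
  The right-hand side is the increment of \<open>b0 R - V - W\<close>. At a true null with nonnegative weight
  the comparison amounts to \<open>(1 + \<psi>\<^sub>j - b0) \<alpha>\<^sub>j \<le> \<phi>\<^sub>j\<close>, which is the second inequality of (G1).
  In the other cases the left-hand side is zero, and the right-hand side is nonnegative: at a true
  null because the weight is negative, elsewhere by the first inequality of (G1).
\<close>
lemma budget_incr_le:
  assumes gai: "gai_rule w0 b0 a \<phi> \<psi>" and j: "1 \<le> j" "length s = j - 1"
  shows "budget_incr b0 a \<psi> \<theta> j s \<rho> \<le>
    of_bool \<rho> * (b0 - of_bool (\<theta> j = 0) - \<psi> j s) + \<phi> j s"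
proof -
  have nn: "0 \<le> a j s" "0 \<le> \<phi> j s" "\<psi> j s \<le> \<phi> j s + b0"
    and ratio: "0 < a j s \<Longrightarrow> \<psi> j s \<le> \<phi> j s / a j s + b0 - 1"
    using gai j by (auto simp: gai_rule_def G1_def)
  have price: "(1 + \<psi> j s - b0) * a j s \<le> \<phi> j s"
  proof (cases "a j s = 0")
    case False
    with nn ratio have "1 + \<psi> j s - b0 \<le> \<phi> j s / a j s"
      by simp
    with False nn show ?thesis
      by (simp add: pos_le_divide_eq)
  qed (use nn in simp)
  show ?thesis
  proof (cases "\<theta> j = 0 \<and> 0 \<le> 1 + \<psi> j s - b0")
    case True
    with price show ?thesis
      by (cases \<rho>) (auto simp: budget_incr_def max_def algebra_simps)
  next
    case False
    with nn show ?thesis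
      by (cases \<rho>) (auto simp: budget_incr_def max_def)
  qed
qed

lemma budget_le:
  assumes gai: "gai_rule w0 b0 a \<phi> \<psi>"
  shows "budget \<gamma> w0 b0 a \<psi> \<theta> n (decisions a x n) \<le>
    \<gamma> - b0 + b0 * num_rejections a x n - num_false_rejections a \<theta> x n"
proof -
  have "budget \<gamma> w0 b0 a \<psi> \<theta> n (decisions a x n) \<le>
      \<gamma> - b0 + b0 * num_rejections a x n - num_false_rejections a \<theta> x n
        - potential w0 \<phi> \<psi> n (decisions a x n)"
  proof (induction n)
    case 0
    then show ?case
      by (simp add: num_rejections_def num_false_rejections_def)
  next
    case (Suc n)
    have "budget_incr b0 a \<psi> \<theta> (Suc n) (decisions a x n) (rejected a x (Suc n)) \<le>
        of_bool (rejected a x (Suc n))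
          * (b0 - of_bool (\<theta> (Suc n) = 0) - \<psi> (Suc n) (decisions a x n))
        + \<phi> (Suc n) (decisions a x n)"
      by (rule budget_incr_le[OF gai]) auto
    with Suc show ?case
      unfolding budget_Suc potential_Suc num_rejections_Suc num_false_rejections_Suc
      by (cases "rejected a x (Suc n)") (auto simp: algebra_simps)
  qed
  with potential_nonneg[OF gai, of n x] show ?thesis
    by linarith
qed

text \<open>
  A positive budget gives \<open>V(n) < \<gamma> - b0 + b0 R(n)\<close>. Bounding each proportion by \<open>\<gamma>\<close> alone
  would leave room for a supremum equal to \<open>\<gamma>\<close>, so a bound that is uniform in \<open>n\<close> is needed. For
  at least two rejections the inequality yields \<open>(\<gamma> + b0) / 2\<close>; for at most one rejection the
  proportion is \<open>0\<close> or \<open>1\<close>, and it is \<open>1\<close> only if \<open>1 < \<gamma>\<close>.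
\<close>
lemma SUP_FDP_less:
  fixes \<gamma> :: real
  assumes gai: "gai_rule w0 b0 a \<phi> \<psi>" and G3: "G3 \<gamma> w0 b0"
    and pos: "\<And>n. 0 < budget \<gamma> w0 b0 a \<psi> \<theta> n (decisions a x n)"
  shows "(SUP n\<in>{1..}. FDP a \<theta> x n) < \<gamma>"
proof -
  have b0: "0 < b0" "b0 < \<gamma>"
    using gai G3 by (auto simp: gai_rule_def G3_def)
  define \<delta> where "\<delta> = max ((\<gamma> + b0) / 2) (of_bool (1 < \<gamma>))"
  have "FDP a \<theta> x n \<le> \<delta>" for n
  proof -
    define R V where "R = num_rejections a x n" and "V = num_false_rejections a \<theta> x n"
    have VR: "V \<le> R"
      by (simp add: R_def V_def num_false_rejections_le)
    have V_less: "real V < \<gamma> - b0 + b0 * real R"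
      using pos[of n] budget_le[OF gai, of \<gamma> \<theta> n x] by (simp add: R_def V_def)
    have FDP_eq: "FDP a \<theta> x n = real V / real (max R 1)"
      by (simp add: FDP_def R_def V_def)
    consider "V = 0" | "R = 1" "V = 1" | "2 \<le> R"
      using VR by linarith
    then show ?thesis
    proof cases
      case 1
      with b0 show ?thesis
        by (simp add: FDP_eq \<delta>_def max_def)
    next
      case 2
      with V_less show ?thesis
        by (simp add: FDP_eq \<delta>_def)
    next
      case 3
      then have "(\<gamma> - b0) * 2 \<le> (\<gamma> - b0) * real R"
        using b0 by (intro mult_left_mono) auto
      with V_less have "real V \<le> (\<gamma> + b0) / 2 * real R"
        by (simp add: algebra_simps)
      with 3 have "FDP a \<theta> x n \<le> (\<gamma> + b0) / 2"
        by (simp add: FDP_eq pos_divide_le_eq)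
      then show ?thesis
        unfolding \<delta>_def by (rule max.coboundedI1)
    qed
  qed
  then have "(SUP n\<in>{1..}. FDP a \<theta> x n) \<le> \<delta>"
    by (intro cSUP_least) auto
  also have "\<delta> < \<gamma>"
    using b0 by (auto simp: \<delta>_def)
  finally show ?thesis .
qed


section \<open>Control of the false discovery exceedance\<close>

text \<open>
  Conditionally on the first \<open>n\<close> decisions, the indicator of \<open>S\<close>, the weight and the level are
  constants, so conditional superuniformity can be integrated against the first two.
\<close>
lemma budget_step_nonneg:
  fixes p :: "nat \<Rightarrow> 'w \<Rightarrow> real" and \<theta> :: "nat \<Rightarrow> 't::zero" and S :: "bool list set"
  assumes model: "p_value_model \<Theta> \<Omega> P p" and csu: "cond_superuniform \<Theta> \<Omega> P p a"
    and \<theta>: "\<theta> \<in> parameters \<Theta>"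
  shows "0 \<le> (\<integral>\<omega>. indicator S (decisions a (\<lambda>k. p k \<omega>) n) *
    budget_incr b0 a \<psi> \<theta> (Suc n) (decisions a (\<lambda>k. p k \<omega>) n)
      (rejected a (\<lambda>k. p k \<omega>) (Suc n)) \<partial>P \<theta>)"
proof (cases "\<theta> (Suc n) = 0")
  case False
  then show ?thesis
    by (simp add: budget_incr_def)
next
  case True
  interpret prob_space "P \<theta>"
    using model \<theta> by (simp add: p_value_model_def)
  have sets_eq: "sets (P \<theta>) = sets \<Omega>"
    using model \<theta> by (simp add: p_value_model_def)
  have p_meas: "\<And>i. 1 \<le> i \<Longrightarrow> p i \<in> borel_measurable \<Omega>"
    using model by (simp add: p_value_model_def)
  define F where "F = decision_algebra \<Omega> p a n"
  have sub: "subalgebra (P \<theta>) F"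
    unfolding F_def by (rule subalgebra_decision_algebra[OF sets_eq p_meas])
  interpret finite_measure_subalgebra "P \<theta>" F
    by unfold_locales (rule sub)
  define H where "H = (\<lambda>\<omega>. decisions a (\<lambda>k. p k \<omega>) n)"
  have H_F [measurable]: "H \<in> F \<rightarrow>\<^sub>M count_space UNIV"
    unfolding H_def F_def by (rule measurable_decisions_decision_algebra) simp
  have H_P: "H \<in> P \<theta> \<rightarrow>\<^sub>M count_space UNIV"
    by (rule measurable_from_subalg[OF sub H_F])
  have intH: "integrable (P \<theta>) (\<lambda>\<omega>. g (H \<omega>))" for g :: "bool list \<Rightarrow> real"
    unfolding H_def
    by (rule integrable_finite_history[OF finite_measure_axioms H_P[unfolded H_def]])
  define B where "B = {\<omega> \<in> space \<Omega>. rejected a (\<lambda>k. p k \<omega>) (Suc n)}"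
  have B_sets [measurable]: "B \<in> sets (P \<theta>)"
    unfolding B_def sets_eq by (rule rejected_sets[OF p_meas]) simp_all
  define g where "g s = indicator S s * max 0 (1 + \<psi> (Suc n) s - b0)" for s
  have g_nonneg: "0 \<le> g s" for s
    by (simp add: g_def)
  have gF: "(\<lambda>\<omega>. g (H \<omega>)) \<in> borel_measurable F"
    by measurable
  have intB: "integrable (P \<theta>) (\<lambda>\<omega>. g (H \<omega>) * indicator B \<omega>)"
    using integrable_mult_indicator[OF B_sets intH[of g]] by (simp add: mult.commute)
  have cond: "AE \<omega> in P \<theta>. real_cond_exp (P \<theta>) F (indicator B) \<omega> \<le> a (Suc n) (H \<omega>)"
    using csu[unfolded cond_superuniform_def, rule_format, of "Suc n" \<theta>] \<theta> True
    by (simp add: F_def B_def H_def rejected_def)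
  have "(\<integral>\<omega>. g (H \<omega>) * indicator B \<omega> \<partial>P \<theta>)
      = (\<integral>\<omega>. g (H \<omega>) * real_cond_exp (P \<theta>) F (indicator B) \<omega> \<partial>P \<theta>)"
    by (rule real_cond_exp_intg(2)[OF intB gF, symmetric]) simp
  also have "\<dots> \<le> (\<integral>\<omega>. g (H \<omega>) * a (Suc n) (H \<omega>) \<partial>P \<theta>)"
  proof (rule integral_mono_AE)
    show "integrable (P \<theta>) (\<lambda>\<omega>. g (H \<omega>) * real_cond_exp (P \<theta>) F (indicator B) \<omega>)"
      by (rule real_cond_exp_intg(1)[OF intB gF]) simp
    show "AE \<omega> in P \<theta>. g (H \<omega>) * real_cond_exp (P \<theta>) F (indicator B) \<omega> \<le> g (H \<omega>) * a (Suc n) (H \<omega>)"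
      using cond by eventually_elim (rule mult_left_mono[OF _ g_nonneg])
  qed (rule intH)
  finally have "0 \<le> (\<integral>\<omega>. g (H \<omega>) * a (Suc n) (H \<omega>) - g (H \<omega>) * indicator B \<omega> \<partial>P \<theta>)"
    using intH[of "\<lambda>s. g s * a (Suc n) s"] intB by simp
  also have "\<dots> = (\<integral>\<omega>. indicator S (H \<omega>) *
      budget_incr b0 a \<psi> \<theta> (Suc n) (H \<omega>) (rejected a (\<lambda>k. p k \<omega>) (Suc n)) \<partial>P \<theta>)"
    using True sets_eq_imp_space_eq[OF sets_eq]
    by (intro Bochner_Integration.integral_cong refl)
      (auto simp: budget_incr_def g_def B_def indicator_def algebra_simps)
  finally show ?thesis
    by (simp add: H_def)
qed

theorem theorem6p1:
  fixes \<alpha> \<gamma> w0 b0 :: real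
    and a \<phi> \<psi> :: "nat \<Rightarrow> bool list \<Rightarrow> real"
    and \<Theta> :: "'t::zero set"
    and \<Omega> :: "'w measure"
    and P :: "(nat \<Rightarrow> 't) \<Rightarrow> 'w measure"
    and p :: "nat \<Rightarrow> 'w \<Rightarrow> real"
  assumes "0 < \<alpha>" and "\<alpha> < 1" and "0 \<le> \<gamma>"
    and "p_value_model \<Theta> \<Omega> P p"
    and "cond_superuniform \<Theta> \<Omega> P p a"
    and "gai_rule w0 b0 a \<phi> \<psi>"
    and "G3 \<gamma> w0 b0"
    and "G4 \<alpha> \<gamma> w0 b0 a \<psi>"
  shows "FDX \<gamma> \<Theta> \<Omega> P p a \<le> ennreal \<alpha>"
  unfolding FDX_def
proof (rule SUP_least)
  fix \<theta> assume \<theta>: "\<theta> \<in> parameters \<Theta>"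
  interpret prob_space "P \<theta>"
    using assms \<theta> by (simp add: p_value_model_def)
  have sets_eq: "sets (P \<theta>) = sets \<Omega>"
    using assms \<theta> by (simp add: p_value_model_def)
  then have space_eq: "space (P \<theta>) = space \<Omega>"
    by (rule sets_eq_imp_space_eq)
  have p_meas: "\<And>i. 1 \<le> i \<Longrightarrow> p i \<in> borel_measurable (P \<theta>)"
    using assms by (simp add: p_value_model_def measurable_cong_sets[OF sets_eq refl])
  define x where "x \<omega> = (\<lambda>k. p k \<omega>)" for \<omega>
  define X where "X n \<omega> = budget \<gamma> w0 b0 a \<psi> \<theta> n (decisions a (x \<omega>) n)" for n \<omega>
  have x0: "0 < \<gamma> - b0 - w0"
    using assms by (simp add: G3_def)
  have int: "integrable (P \<theta>) (X n)" for n
    unfolding X_def x_def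
    by (rule integrable_finite_history[OF finite_measure_axioms measurable_decisions])
      (auto intro: rejected_sets[OF p_meas])
  have [measurable]: "\<And>n. X n \<in> borel_measurable (P \<theta>)"
    using int by auto
  have "(\<gamma> - b0 - w0) / ((\<gamma> - b0 - w0) / (1 - \<alpha>)) \<le> prob {\<omega> \<in> space (P \<theta>). \<forall>n. 0 < X n \<omega>}"
  proof (rule positivity_probability[OF int _ x0])
    show "X 0 \<omega> = \<gamma> - b0 - w0" for \<omega>
      by (simp add: X_def)
    show "X n \<omega> \<le> (\<gamma> - b0 - w0) / (1 - \<alpha>)" for n \<omega>
      unfolding X_def by (rule budget_le_cap) (use assms in auto)
    show "(\<integral>\<omega>. indicator {\<omega> \<in> space (P \<theta>). \<forall>k\<le>n. 0 < X k \<omega>} \<omega> * (X (Suc n) \<omega> - X n \<omega>) \<partial>P \<theta>) \<ge> 0"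
      for n
    proof -
      \<comment> \<open>Positivity of the budget so far, as a set of histories.\<close>
      define S where "S = {s. \<forall>k\<le>n. 0 < budget \<gamma> w0 b0 a \<psi> \<theta> k (take k s)}"
      have "0 \<le> (\<integral>\<omega>. indicator S (decisions a (x \<omega>) n) *
          budget_incr b0 a \<psi> \<theta> (Suc n) (decisions a (x \<omega>) n) (rejected a (x \<omega>) (Suc n)) \<partial>P \<theta>)"
        unfolding x_def by (rule budget_step_nonneg[OF assms(4,5) \<theta>])
      also have "\<dots> = (\<integral>\<omega>. indicator {\<omega> \<in> space (P \<theta>). \<forall>k\<le>n. 0 < X k \<omega>} \<omega> * (X (Suc n) \<omega> - X n \<omega>) \<partial>P \<theta>)"
        by (intro Bochner_Integration.integral_cong refl)
          (auto simp: S_def X_def budget_Suc indicator_def take_decisions)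
      finally show ?thesis .
    qed
  qed
  then have safe: "1 - \<alpha> \<le> prob {\<omega> \<in> space (P \<theta>). \<forall>n. 0 < X n \<omega>}"
    using x0 by simp
  have "emeasure (P \<theta>) {\<omega> \<in> space \<Omega>. (SUP n\<in>{1..}. FDP a \<theta> (\<lambda>k. p k \<omega>) n) \<ge> \<gamma>}
      \<le> emeasure (P \<theta>) (space (P \<theta>) - {\<omega> \<in> space (P \<theta>). \<forall>n. 0 < X n \<omega>})"
  proof (rule emeasure_mono)
    show "{\<omega> \<in> space \<Omega>. (SUP n\<in>{1..}. FDP a \<theta> (\<lambda>k. p k \<omega>) n) \<ge> \<gamma>}
        \<subseteq> space (P \<theta>) - {\<omega> \<in> space (P \<theta>). \<forall>n. 0 < X n \<omega>}"
    proof safe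
      fix \<omega> assume "(SUP n\<in>{1..}. FDP a \<theta> (\<lambda>k. p k \<omega>) n) \<ge> \<gamma>" and "\<forall>n. 0 < X n \<omega>"
      then show False
        using SUP_FDP_less[OF assms(6,7), of \<theta> "x \<omega>"] by (simp add: X_def x_def)
    qed (simp add: space_eq)
  qed measurable
  also have "\<dots> \<le> ennreal \<alpha>"
    using safe by (simp add: emeasure_eq_measure prob_compl ennreal_leI)
  finally show "emeasure (P \<theta>) {\<omega> \<in> space \<Omega>. (SUP n\<in>{1..}. FDP a \<theta> (\<lambda>k. p k \<omega>) n) \<ge> \<gamma>} \<le> ennreal \<alpha>" .
qed

end
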